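(* Let $(G,p)$ be a finite well-positioned bar-joint framework in $(\mathbb{R}^d,\|\cdot\|_{\mathcal{P}})$, where $\|\cdot\|_{\mathcal{P}}$ is a polyhedral norm. Then the following statements are equivalent: (i) $(G,p)$ is continuously rigid; (ii) $(G,p)$ is infinitesimally rigid.
   Context: Let $d\ge 2$ and let $\mathcal{P}\subset\mathbb{R}^d$ be a convex symmetric ($\mathcal P=-\mathcal P$) $d$-dimensional polytope. The associated polyhedral norm is $\|x\|_{\mathcal{P}}=\inf\{\lambda\ge 0: x\in\lambda\mathcal{P}\}$. For a facet $F$ of $\mathcal P$, $\mathrm{cone}(F)$ is the set of all finite non-negative linear combinations of points of $F$. A bar-joint framework $(G,p)$ consists of a simple undirected graph $G=(V(G),E(G))$ and a map $p:V(G)\to\mathbb{R}^d$ with $p_v\neq p_w$ whenever $vw\in E(G)$; it is finite if $G$ is finite. It is well-positioned if for each edge $vw$ the vector $p_v-p_w$ is contained in $\mathrm{cone}(F)$ for exactly one facet $F$ of $\mathcal{P}$. A continuous (or finite) flex of $(G,p)$ is a family of continuous paths $\alpha_v:(-\delta,\delta)\to\mathbb{R}^d$, $v\in V(G)$, with $\alpha_v(0)=p_v$ for all $v$ and $\|\alpha_v(t)-\alpha_w(t)\|_{\mathcal{P}}=\|p_v-p_w\|_{\mathcal{P}}$ for all $|t|<\delta$ and each edge $vw\in E(G)$. Such a flex is trivial if it is the restriction to the points $p_v$ of a continuous rigid motion of $(\mathbb{R}^d,\|\cdot\|_{\mathcal P})$; since these rigid motions are translational near $t=0$, this means that (after shrinking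 $\delta$ if necessary) there is a continuous $c:(-\delta,\delta)\to\mathbb{R}^d$ with $\alpha_v(t)=p_v+c(t)$ for all $v\in V(G)$ and $|t|<\delta$. $(G,p)$ is continuously rigid if every continuous flex of it is trivial. An infinitesimal flex of $(G,p)$ is a map $u:V(G)\to\mathbb{R}^d$ such that for each edge $vw$, $\|(p_v+tu_v)-(p_w+tu_w)\|_{\mathcal{P}}-\|p_v-p_w\|_{\mathcal{P}}=o(t)$ as $t\to 0$. It is trivial if it is constant. $(G,p)$ is infinitesimally rigid if every infinitesimal flex is trivial. *)

theory Defs
  imports "HOL-Analysis.Analysis" "HOL-Library.Landau_Symbols" "HOL-Library.Ramsey"
begin

section \<open>Polyhedral norms\<close>

definition polyhedral_norm :: "'a::euclidean_space set \<Rightarrow> 'a \<Rightarrow> real" where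
  "polyhedral_norm P x = Inf {l. 0 \<le> l \<and> x \<in> (\<lambda>y. l *\<^sub>R y) ` P}"

definition symmetric_polytope :: "'a::euclidean_space set \<Rightarrow> bool" where
  "symmetric_polytope P \<longleftrightarrow> polytope P \<and> P = uminus ` P \<and> aff_dim P = int DIM('a)"

text \<open>Not to be confused with the library predicate \<open>cone\<close>, which says that a given set is
  closed under non-negative scaling.\<close>

definition cone_of :: "'a::real_vector set \<Rightarrow> 'a set" where
  "cone_of F = {(\<Sum>x\<in>S. c x *\<^sub>R x) | S c. finite S \<and> S \<subseteq> F \<and> (\<forall>x\<in>S. 0 \<le> c x)}"

section \<open>Bar-joint frameworks\<close>

text \<open>A simple undirected graph is a vertex set \<open>V\<close> with a set \<open>E\<close> of two-element subsets
  of \<open>V\<close>. Functions on the vertices (placements, flexes) are total functions on the ambient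
  type; only their values on \<open>V\<close> are ever used.\<close>

definition simple_graph :: "'v set \<Rightarrow> 'v set set \<Rightarrow> bool" where
  "simple_graph V E \<longleftrightarrow> E \<subseteq> nsets V 2"

definition bar_joint_framework ::
    "'v set \<Rightarrow> 'v set set \<Rightarrow> ('v \<Rightarrow> 'a::euclidean_space) \<Rightarrow> bool" where
  "bar_joint_framework V E p \<longleftrightarrow>
     simple_graph V E \<and> (\<forall>v w. {v, w} \<in> E \<longrightarrow> p v \<noteq> p w)"

definition well_positioned ::
    "'a::euclidean_space set \<Rightarrow> 'v set set \<Rightarrow> ('v \<Rightarrow> 'a) \<Rightarrow> bool" where
  "well_positioned P E p \<longleftrightarrow>
     (\<forall>v w. {v, w} \<in> E \<longrightarrow> (\<exists>!F. F facet_of P \<and> p v - p w \<in> cone_of F))"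

section \<open>Continuous rigidity\<close>

definition continuous_flex ::
    "'a::euclidean_space set \<Rightarrow> 'v set \<Rightarrow> 'v set set \<Rightarrow> ('v \<Rightarrow> 'a) \<Rightarrow> real
      \<Rightarrow> ('v \<Rightarrow> real \<Rightarrow> 'a) \<Rightarrow> bool" where
  "continuous_flex P V E p \<delta> \<alpha> \<longleftrightarrow>
     0 < \<delta> \<and>
     (\<forall>v\<in>V. continuous_on {-\<delta><..<\<delta>} (\<alpha> v) \<and> \<alpha> v 0 = p v) \<and>
     (\<forall>v w. {v, w} \<in> E \<longrightarrow>
        (\<forall>t\<in>{-\<delta><..<\<delta>}. polyhedral_norm P (\<alpha> v t - \<alpha> w t) = polyhedral_norm P (p v - p w)))"

text \<open>The continuous rigid motions of a polyhedral normed space are translational near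
  \<open>t = 0\<close>, so a flex is trivial if, possibly on a smaller interval around \<open>0\<close>, it
  is the restriction to the points \<open>p v\<close> of a continuous family of translations.\<close>

definition trivial_continuous_flex ::
    "'v set \<Rightarrow> ('v \<Rightarrow> 'a::euclidean_space) \<Rightarrow> real \<Rightarrow> ('v \<Rightarrow> real \<Rightarrow> 'a) \<Rightarrow> bool" where
  "trivial_continuous_flex V p \<delta> \<alpha> \<longleftrightarrow>
     (\<exists>\<epsilon> c. 0 < \<epsilon> \<and> \<epsilon> \<le> \<delta> \<and> continuous_on {-\<epsilon><..<\<epsilon>} c \<and>
        (\<forall>v\<in>V. \<forall>t\<in>{-\<epsilon><..<\<epsilon>}. \<alpha> v t = p v + c t))"

definition continuously_rigid ::
    "'a::euclidean_space set \<Rightarrow> 'v set \<Rightarrow> 'v set set \<Rightarrow> ('v \<Rightarrow> 'a) \<Rightarrow> bool" where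
  "continuously_rigid P V E p \<longleftrightarrow>
     (\<forall>\<delta> \<alpha>. continuous_flex P V E p \<delta> \<alpha> \<longrightarrow> trivial_continuous_flex V p \<delta> \<alpha>)"

section \<open>Infinitesimal rigidity\<close>

definition infinitesimal_flex ::
    "'a::euclidean_space set \<Rightarrow> 'v set set \<Rightarrow> ('v \<Rightarrow> 'a) \<Rightarrow> ('v \<Rightarrow> 'a) \<Rightarrow> bool" where
  "infinitesimal_flex P E p u \<longleftrightarrow>
     (\<forall>v w. {v, w} \<in> E \<longrightarrow>
        (\<lambda>t::real. polyhedral_norm P ((p v + t *\<^sub>R u v) - (p w + t *\<^sub>R u w))
                     - polyhedral_norm P (p v - p w)) \<in> o[at 0](\<lambda>t. t))"

definition trivial_infinitesimal_flex ::
    "'v set \<Rightarrow> ('v \<Rightarrow> 'a::euclidean_space) \<Rightarrow> bool" where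
  "trivial_infinitesimal_flex V u \<longleftrightarrow> (\<exists>c. \<forall>v\<in>V. u v = c)"

definition infinitesimally_rigid ::
    "'a::euclidean_space set \<Rightarrow> 'v set \<Rightarrow> 'v set set \<Rightarrow> ('v \<Rightarrow> 'a) \<Rightarrow> bool" where
  "infinitesimally_rigid P V E p \<longleftrightarrow>
     (\<forall>u. infinitesimal_flex P E p u \<longrightarrow> trivial_infinitesimal_flex V u)"

end

theory Submission
  imports Defs
begin

text \<open>Writing \<open>P = {x. \<forall>n\<in>N. n \<bullet> x \<le> 1}\<close> with one normal \<open>n\<close> per facet, the norm is the maximum of
  the functionals \<open>n \<bullet> x\<close>, and \<open>x\<close> lies in the cone of a facet whenever the corresponding
  functional attains this maximum. In a well-positioned framework the maximum is attained only once
  at each edge vector, so near the edge vectors the norm is linear. Hence both kinds of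
  flexes are governed by the same linear system: \<open>u\<close> is an infinitesimal flex iff
  \<open>t \<mapsto> p + t u\<close> is a continuous flex for small \<open>t\<close>, and the displacements \<open>\<alpha>(t) - p\<close> of a
  continuous flex are infinitesimal flexes for small \<open>t\<close>.\<close>

section \<open>Facet normals of a symmetric polytope\<close>

text \<open>Full dimension provides an interior point \<open>x\<close>; by symmetry
  \<open>- x\<close> is interior too, and the interior is convex, so it contains their
  midpoint.\<close>

lemma zero_in_interior_symmetric_polytope:
  assumes "symmetric_polytope P"
  shows "0 \<in> interior P"
proof -
  have conv: "convex P" and sym: "P = uminus ` P" and dim: "aff_dim P = int DIM('a)"
    using assms by (auto simp: symmetric_polytope_def polytope_imp_convex)
  have "interior P \<noteq> {}"
    using dim aff_dim_eq_full interior_rel_interior_gen[of P] rel_interior_eq_empty[OF conv]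
    by (metis aff_dim_empty_eq of_nat_less_0_iff zero_less_one neg_less_0_iff_less of_nat_0_le_iff not_less)
  then obtain x where x: "x \<in> interior P" by blast
  then have "- x \<in> interior P"
    using interior_negations[of P] sym by (metis image_eqI)
  then have "(1/2) *\<^sub>R x + (1/2) *\<^sub>R (- x) \<in> interior P"
    by (intro convexD[OF convex_interior[OF conv] x]) auto
  then show ?thesis by simp
qed

text \<open>In an irredundant half-space description the facets are exactly the sets where one
  constraint is tight. As 0 is interior, every right-hand side is positive and can be scaled to
  1.\<close>

lemma symmetric_polytope_facet_normals:
  fixes P :: "'a::euclidean_space set"
  assumes "symmetric_polytope P"
  obtains N where "finite N" "P = {x. \<forall>n\<in>N. n \<bullet> x \<le> 1}"
    "\<And>C. C facet_of P \<longleftrightarrow> (\<exists>n\<in>N. C = P \<inter> {x. n \<bullet> x = 1})"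
proof -
  have "polyhedron P" and "affine hull P = UNIV"
    using assms polytope_imp_polyhedron aff_dim_eq_full
    by (auto simp: symmetric_polytope_def)
  then obtain H where H: "finite H" "P = affine hull P \<inter> \<Inter>H"
      "\<forall>h\<in>H. \<exists>a b. a \<noteq> 0 \<and> h = {x. a \<bullet> x \<le> b}"
      "\<And>H'. H' \<subset> H \<Longrightarrow> P \<subset> affine hull P \<inter> \<Inter>H'"
    unfolding polyhedron_Int_affine_minimal by auto
  from H(3) obtain a b where ab: "\<And>h. h \<in> H \<Longrightarrow> a h \<noteq> 0 \<and> h = {x. a h \<bullet> x \<le> b h}"
    by metis
  have P: "P = \<Inter>H" using H(2) \<open>affine hull P = UNIV\<close> by simp
  have facet: "C facet_of P \<longleftrightarrow> (\<exists>h. h \<in> H \<and> C = P \<inter> {x. a h \<bullet> x = b h})" for C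
    by (rule facet_of_polyhedron_explicit[OF H(1,2) ab H(4)])
  have pos: "0 < b h" if "h \<in> H" for h
  proof -
    have "P \<subseteq> {x. a h \<bullet> x \<le> b h}" using P ab[OF that] that by blast
    then have "0 \<in> interior {x. a h \<bullet> x \<le> b h}"
      using zero_in_interior_symmetric_polytope[OF assms] interior_mono by blast
    moreover have "interior {x. a h \<bullet> x \<le> b h} = {x. a h \<bullet> x < b h}"
      using ab[OF that] by (intro interior_halfspace_le) blast
    ultimately show ?thesis by simp
  qed
  define n where "n h = a h /\<^sub>R b h" for h
  have le: "n h \<bullet> x \<le> 1 \<longleftrightarrow> a h \<bullet> x \<le> b h" and eq: "n h \<bullet> x = 1 \<longleftrightarrow> a h \<bullet> x = b h"
    if "h \<in> H" for h x
    using pos[OF that] by (auto simp: n_def field_simps)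
  have "x \<in> h \<longleftrightarrow> a h \<bullet> x \<le> b h" if "h \<in> H" for h x
    using ab[OF that] by blast
  then have "P = {x. \<forall>m\<in>n ` H. m \<bullet> x \<le> 1}"
    using P le by auto
  moreover have "C facet_of P \<longleftrightarrow> (\<exists>m\<in>n ` H. C = P \<inter> {x. m \<bullet> x = 1})" for C
    unfolding facet using eq by auto
  ultimately show ?thesis using that[of "n ` H"] H(1) by blast
qed

section \<open>The norm as a maximum of facet functionals\<close>

text \<open>For \<open>l > 0\<close>, \<open>x\<close> lies in \<open>l P\<close> iff no functional
  exceeds \<open>l\<close> at \<open>x\<close>, and only the largest one matters. That one is
  positive, since otherwise the whole ray through \<open>x\<close> would stay in the bounded set
  \<open>P\<close>.\<close>

lemma polyhedral_norm_eq_max_normal: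
  assumes P: "P = {x. \<forall>n\<in>N. n \<bullet> x \<le> 1}" and "bounded P"
    and "x \<noteq> 0" "n \<in> N" and max: "\<And>m. m \<in> N \<Longrightarrow> m \<bullet> x \<le> n \<bullet> x"
  shows "0 < n \<bullet> x" "polyhedral_norm P x = n \<bullet> x"
proof -
  show pos: "0 < n \<bullet> x"
  proof (rule ccontr)
    assume neg: "\<not> 0 < n \<bullet> x"
    obtain B where B: "\<And>y. y \<in> P \<Longrightarrow> norm y \<le> B"
      using \<open>bounded P\<close> bounded_iff by blast
    \<comment> \<open>Chosen so that \<open>l *\<^sub>R x\<close> has norm
      \<open>\<bar>B\<bar> + 1\<close>, which exceeds the bound \<open>B\<close>.\<close>
    define l where "l = (\<bar>B\<bar> + 1) / norm x"
    have "0 \<le> l" by (simp add: l_def)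
    have "m \<bullet> (l *\<^sub>R x) \<le> 1" if "m \<in> N" for m
      using max[OF that] neg mult_nonneg_nonpos[OF \<open>0 \<le> l\<close>, of "m \<bullet> x"] by simp
    then have "norm (l *\<^sub>R x) \<le> B" using B P by blast
    then show False using \<open>x \<noteq> 0\<close> by (simp add: l_def)
  qed
  have "0 \<le> l \<and> x \<in> (\<lambda>y. l *\<^sub>R y) ` P \<longleftrightarrow> n \<bullet> x \<le> l" for l
  proof
    assume "0 \<le> l \<and> x \<in> (\<lambda>y. l *\<^sub>R y) ` P"
    then obtain y where "0 \<le> l" "x = l *\<^sub>R y" "n \<bullet> y \<le> 1"
      using P \<open>n \<in> N\<close> by auto
    then show "n \<bullet> x \<le> l" using mult_left_mono[of "n \<bullet> y" 1 l] by simp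
  next
    assume l: "n \<bullet> x \<le> l"
    then have "m \<bullet> (x /\<^sub>R l) \<le> 1" if "m \<in> N" for m
      using max[OF that] pos by (simp add: field_simps)
    then have "x /\<^sub>R l \<in> P" using P by blast
    moreover have "x = l *\<^sub>R (x /\<^sub>R l)" using l pos by simp
    ultimately show "0 \<le> l \<and> x \<in> (\<lambda>y. l *\<^sub>R y) ` P"
      using l pos by (metis image_eqI less_imp_le order_trans)
  qed
  then have "{l. 0 \<le> l \<and> x \<in> (\<lambda>y. l *\<^sub>R y) ` P} = {n \<bullet> x..}"
    by auto
  then show "polyhedral_norm P x = n \<bullet> x"
    by (simp add: polyhedral_norm_def)
qed

lemma scaleR_in_cone_of:
  assumes "y \<in> F" "0 \<le> c"
  shows "c *\<^sub>R y \<in> cone_of F"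
  unfolding cone_of_def using assms
  by (intro CollectI exI[of _ "{y}"] exI[of _ "\<lambda>_. c"]) auto

text \<open>A facet determines its normal, because its affine hull is a hyperplane avoiding \<open>0\<close>.\<close>

lemma facet_normal_unique:
  fixes C :: "'a::euclidean_space set"
  assumes "aff_dim C = int DIM('a) - 1" "C \<noteq> {}"
    and "C \<subseteq> {x. m \<bullet> x = 1}" "C \<subseteq> {x. n \<bullet> x = 1}"
  shows "m = n"
proof (rule ccontr)
  assume "m \<noteq> n"
  have "affine hull C \<subseteq> {x. (m - n) \<bullet> x = 0}"
    using assms(3,4) by (intro hull_minimal affine_hyperplane) (fastforce simp: inner_diff_left)
  then have "affine hull C = {x. (m - n) \<bullet> x = 0}"
    using assms(1,2) \<open>m \<noteq> n\<close>
    by (intro affine_dim_equal affine_affine_hull affine_hyperplane) auto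
  then have "0 \<in> affine hull C" by simp
  moreover have "affine hull C \<subseteq> {x. n \<bullet> x = 1}"
    using assms(4) by (intro hull_minimal affine_hyperplane)
  ultimately show False by auto
qed

text \<open>Every normal maximal at \<open>x\<close> yields a facet whose cone contains
  \<open>x\<close>, so uniqueness leaves a single maximal normal. Its strict lead over the finitely
  many others persists near \<open>x\<close>.\<close>

lemma polyhedral_norm_locally_linear:
  fixes P :: "'a::euclidean_space set"
  assumes sp: "symmetric_polytope P" and "x \<noteq> 0"
    and unique: "\<exists>!F. F facet_of P \<and> x \<in> cone_of F"
  obtains n where "\<forall>\<^sub>F y in nhds x. polyhedral_norm P y = n \<bullet> y"
proof -
  have bdd: "bounded P" and dim: "aff_dim P = int DIM('a)"
    using sp by (auto simp: symmetric_polytope_def polytope_imp_bounded)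
  obtain N where N: "finite N" "P = {x. \<forall>n\<in>N. n \<bullet> x \<le> 1}"
    "\<And>C. C facet_of P \<longleftrightarrow> (\<exists>n\<in>N. C = P \<inter> {x. n \<bullet> x = 1})"
    using symmetric_polytope_facet_normals[OF sp] by blast
  have "N \<noteq> {}" using N(2) bdd not_bounded_UNIV[where 'a='a] by auto
  define maximal where "maximal n \<longleftrightarrow> n \<in> N \<and> (\<forall>m\<in>N. m \<bullet> x \<le> n \<bullet> x)" for n
  define facet where "facet n = P \<inter> {x. n \<bullet> x = 1}" for n
  have facet: "facet n facet_of P" "x \<in> cone_of (facet n)" if "maximal n" for n
  proof -
    have n: "n \<in> N" "\<And>m. m \<in> N \<Longrightarrow> m \<bullet> x \<le> n \<bullet> x"
      using that by (auto simp: maximal_def)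
    show "facet n facet_of P" using N(3) n(1) facet_def by blast
    have pos: "0 < n \<bullet> x" by (rule polyhedral_norm_eq_max_normal(1)[OF N(2) bdd \<open>x \<noteq> 0\<close> n])
    \<comment> \<open>The ray through \<open>x\<close> meets the boundary of \<open>P\<close> here;
      scaling back puts \<open>x\<close> in the cone.\<close>
    then have "x /\<^sub>R (n \<bullet> x) \<in> facet n"
      using n(2) by (simp add: facet_def N(2) field_simps)
    from scaleR_in_cone_of[OF this, of "n \<bullet> x"] show "x \<in> cone_of (facet n)"
      using pos by simp
  qed
  obtain n where "n \<in> N" "n \<bullet> x = Max ((\<lambda>m. m \<bullet> x) ` N)"
    using Max_in[of "(\<lambda>m. m \<bullet> x) ` N"] N(1) \<open>N \<noteq> {}\<close> by fastforce
  then have n: "maximal n" using N(1) by (simp add: maximal_def)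
  have strict: "m \<bullet> x < n \<bullet> x" if "m \<in> N" "m \<noteq> n" for m
  proof (rule ccontr)
    assume "\<not> m \<bullet> x < n \<bullet> x"
    then have "maximal m" using n \<open>m \<in> N\<close> by (force simp: maximal_def)
    then have "facet m = facet n" using facet n unique by blast
    then have "m = n"
      using facet(1)[OF n] dim facet_normal_unique[of "facet n" m n]
      by (auto simp: facet_of_def facet_def)
    with that show False by simp
  qed
  have "\<forall>\<^sub>F y in nhds x. m \<bullet> y \<le> n \<bullet> y" if "m \<in> N" for m
  proof (cases "m = n")
    case False
    have "open {y. m \<bullet> y < n \<bullet> y}" by (intro open_Collect_less continuous_intros)
    then have "\<forall>\<^sub>F y in nhds x. m \<bullet> y < n \<bullet> y"
      using strict[OF that False] eventually_nhds by blast
    then show ?thesis by eventually_elim simp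
  qed simp
  then have "\<forall>\<^sub>F y in nhds x. \<forall>m\<in>N. m \<bullet> y \<le> n \<bullet> y"
    using N(1) by (simp add: eventually_ball_finite)
  \<comment> \<open>The maximum formula is applied at each nearby \<open>y\<close>, and it is stated
    for nonzero vectors.\<close>
  moreover have "\<forall>\<^sub>F y in nhds x. y \<noteq> 0" using \<open>x \<noteq> 0\<close> t1_space_nhds by blast
  ultimately have "\<forall>\<^sub>F y in nhds x. polyhedral_norm P y = n \<bullet> y"
  proof eventually_elim
    case (elim y)
    then show ?case
      using polyhedral_norm_eq_max_normal(2)[OF N(2) bdd, of y n] n by (auto simp: maximal_def)
  qed
  then show ?thesis using that by blast
qed

section \<open>Linearization along the edges\<close>

text \<open>This packs all that the flex arguments use about \<open>P\<close>. An edge is read in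
  both orders, each order with its own functional.\<close>

definition linearizes_edges ::
    "'a::euclidean_space set \<Rightarrow> 'v set set \<Rightarrow> ('v \<Rightarrow> 'a) \<Rightarrow> ('v \<Rightarrow> 'v \<Rightarrow> 'a) \<Rightarrow> bool" where
  "linearizes_edges P E p g \<longleftrightarrow>
     (\<forall>v w. {v, w} \<in> E \<longrightarrow> (\<forall>\<^sub>F y in nhds (p v - p w). polyhedral_norm P y = g v w \<bullet> y))"

lemma well_positioned_linearizes_edges:
  assumes "symmetric_polytope P" "bar_joint_framework V E p" "well_positioned P E p"
  obtains g where "linearizes_edges P E p g"
proof -
  have "\<exists>n. \<forall>\<^sub>F y in nhds (p v - p w). polyhedral_norm P y = n \<bullet> y" if "{v, w} \<in> E" for v w
  proof -
    have "p v - p w \<noteq> 0" "\<exists>!F. F facet_of P \<and> p v - p w \<in> cone_of F"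
      using assms(2,3) that by (auto simp: bar_joint_framework_def well_positioned_def)
    then show ?thesis using polyhedral_norm_locally_linear[OF assms(1)] by metis
  qed
  then obtain g where "\<And>v w. {v, w} \<in> E \<Longrightarrow>
      \<forall>\<^sub>F y in nhds (p v - p w). polyhedral_norm P y = g v w \<bullet> y"
    by metis
  then show ?thesis using that[of g] by (simp add: linearizes_edges_def)
qed

text \<open>An arbitrary filter is allowed so that the same fact serves \<open>at 0\<close> for the
  little-o condition and \<open>nhds 0\<close> for paths.\<close>

lemma linearizes_edges_tendsto:
  assumes "linearizes_edges P E p g" "{v, w} \<in> E"
    and "(q \<longlongrightarrow> p v - p w) F"
  shows "\<forall>\<^sub>F t in F. polyhedral_norm P (q t) - polyhedral_norm P (p v - p w)
                      = g v w \<bullet> (q t - (p v - p w))"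
proof -
  have ev: "\<forall>\<^sub>F y in nhds (p v - p w). polyhedral_norm P y = g v w \<bullet> y"
    using assms(1,2) by (simp add: linearizes_edges_def)
  have "\<forall>\<^sub>F t in F. polyhedral_norm P (q t) = g v w \<bullet> q t"
    using eventually_compose_filterlim[OF ev assms(3)] .
  then show ?thesis
    \<comment> \<open>The filter \<open>nhds\<close> includes its centre, so the linear formula also
      evaluates the norm of \<open>p v - p w\<close>.\<close>
    by eventually_elim (simp add: eventually_nhds_x_imp_x[OF ev] inner_diff_right)
qed

section \<open>Flexes as solutions of a linear system\<close>

text \<open>Near \<open>t = 0\<close> the change of length is exactly a constant times
  \<open>t\<close>, which is \<open>o(t)\<close> only if the constant vanishes.\<close>

lemma infinitesimal_flex_iff:
  assumes "linearizes_edges P E p g"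
  shows "infinitesimal_flex P E p u \<longleftrightarrow> (\<forall>v w. {v, w} \<in> E \<longrightarrow> g v w \<bullet> (u v - u w) = 0)"
proof -
  have "(\<lambda>t::real. polyhedral_norm P ((p v + t *\<^sub>R u v) - (p w + t *\<^sub>R u w))
          - polyhedral_norm P (p v - p w)) \<in> o[at 0](\<lambda>t. t) \<longleftrightarrow> g v w \<bullet> (u v - u w) = 0"
    (is "?f \<in> _ \<longleftrightarrow> _") if "{v, w} \<in> E" for v w
  proof -
    let ?q = "\<lambda>t::real. (p v + t *\<^sub>R u v) - (p w + t *\<^sub>R u w)"
    have "(?q \<longlongrightarrow> ?q 0) (at 0)" by (intro tendsto_intros)
    then have "(?q \<longlongrightarrow> p v - p w) (at 0)" by simp
    from linearizes_edges_tendsto[OF assms that this]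
    have "\<forall>\<^sub>F t in at 0. ?f t = g v w \<bullet> (u v - u w) * t"
      by eventually_elim (simp add: algebra_simps inner_diff_right inner_add_right)
    then have "?f \<in> o[at 0](\<lambda>t. t) \<longleftrightarrow> (\<lambda>t. g v w \<bullet> (u v - u w) * t) \<in> o[at 0](\<lambda>t. t)"
      by (rule landau_o.small.in_cong)
    also have "\<dots> \<longleftrightarrow> g v w \<bullet> (u v - u w) = 0"
    proof (cases "g v w \<bullet> (u v - u w) = 0")
      case False
      \<comment> \<open>After cancelling the nonzero coefficient, \<open>t \<in> o(t)\<close> would
        force \<open>t\<close> to vanish eventually, which the punctured filter \<open>at 0\<close>
        excludes.\<close>
      have "\<not> (\<forall>\<^sub>F t in at (0::real). t = 0)"
      proof
        assume "\<forall>\<^sub>F t in at (0::real). t = 0"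
        then have "\<forall>\<^sub>F t in at (0::real). False"
          using eventually_neq_at_within[of 0 0 UNIV] by eventually_elim simp
        then show False by simp
      qed
      then show ?thesis using False by (simp add: landau_o.small_refl_iff)
    qed simp
    finally show ?thesis .
  qed
  then show ?thesis by (simp add: infinitesimal_flex_def)
qed

text \<open>Finiteness lets the time intervals found for single edges be intersected into
  one.\<close>

lemma finite_edge_pairs:
  assumes "bar_joint_framework V E p" "finite V"
  shows "finite {(v, w). {v, w} \<in> E}"
proof (rule finite_subset)
  show "{(v, w). {v, w} \<in> E} \<subseteq> V \<times> V"
    using assms(1) by (auto simp: bar_joint_framework_def simple_graph_def nsets_def)
qed (simp add: assms)

text \<open>The edge vector moves by \<open>t *\<^sub>R (u v - u w)\<close>, on which
  \<open>g v w\<close> vanishes. Within the region of linearity lengths are therefore kept exactly,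
  not just to first order.\<close>

lemma continuous_flex_of_infinitesimal_flex:
  assumes lin: "linearizes_edges P E p g"
    and fin: "finite {(v, w). {v, w} \<in> E}"
    and u: "infinitesimal_flex P E p u"
  obtains \<delta> where "continuous_flex P V E p \<delta> (\<lambda>v t. p v + t *\<^sub>R u v)"
proof -
  have "\<forall>\<^sub>F t in nhds 0. polyhedral_norm P ((p v + t *\<^sub>R u v) - (p w + t *\<^sub>R u w))
          = polyhedral_norm P (p v - p w)" if e: "{v, w} \<in> E" for v w
  proof -
    let ?q = "\<lambda>t. (p v + t *\<^sub>R u v) - (p w + t *\<^sub>R u w)"
    have "(?q \<longlongrightarrow> ?q 0) (nhds 0)" by (intro tendsto_intros filterlim_ident)
    then have "(?q \<longlongrightarrow> p v - p w) (nhds 0)" by simp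
    from linearizes_edges_tendsto[OF lin e this] show ?thesis
    proof eventually_elim
      case (elim t)
      have "?q t - (p v - p w) = t *\<^sub>R (u v - u w)" by (simp add: algebra_simps)
      moreover have "g v w \<bullet> (u v - u w) = 0" using u e infinitesimal_flex_iff[OF lin] by blast
      ultimately show ?case using elim by simp
    qed
  qed
  then have "\<forall>\<^sub>F t in nhds (0::real). \<forall>(v, w)\<in>{(v, w). {v, w} \<in> E}.
      polyhedral_norm P ((p v + t *\<^sub>R u v) - (p w + t *\<^sub>R u w)) = polyhedral_norm P (p v - p w)"
    by (intro eventually_ball_finite fin) auto
  then obtain \<delta> where "0 < \<delta>" and \<delta>: "\<And>t v w. \<bar>t\<bar> < \<delta> \<Longrightarrow> {v, w} \<in> E \<Longrightarrow>
      polyhedral_norm P ((p v + t *\<^sub>R u v) - (p w + t *\<^sub>R u w)) = polyhedral_norm P (p v - p w)"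
    unfolding eventually_nhds_metric by (auto simp: dist_real_def)
  then have "continuous_flex P V E p \<delta> (\<lambda>v t. p v + t *\<^sub>R u v)"
    unfolding continuous_flex_def by (auto intro!: continuous_intros)
  then show ?thesis using that by blast
qed

text \<open>The paths are merely continuous, so velocities may not exist. Displacements replace
  them: equal lengths within the region of linearity say that \<open>g v w\<close> vanishes on the
  change of the edge vector.\<close>

lemma infinitesimal_flex_of_continuous_flex:
  assumes lin: "linearizes_edges P E p g"
    and fin: "finite {(v, w). {v, w} \<in> E}"
    and graph: "bar_joint_framework V E p"
    and \<alpha>: "continuous_flex P V E p \<delta> \<alpha>"
  shows "\<forall>\<^sub>F t in nhds 0. infinitesimal_flex P E p (\<lambda>v. \<alpha> v t - p v)"
proof -
  have "0 < \<delta>" using \<alpha> by (simp add: continuous_flex_def)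
  have lim: "(\<alpha> v \<longlongrightarrow> p v) (nhds 0)" if "v \<in> V" for v
  proof -
    have "isCont (\<alpha> v) 0"
      using \<alpha> \<open>0 < \<delta>\<close> that
      by (auto simp: continuous_flex_def continuous_on_eq_continuous_at)
    then show ?thesis
      using \<alpha> that by (simp add: continuous_flex_def continuous_at tendsto_at_iff_tendsto_nhds)
  qed
  have small: "\<forall>\<^sub>F t in nhds 0. t \<in> {-\<delta><..<\<delta>}"
    using \<open>0 < \<delta>\<close> by (intro eventually_nhds_in_open) auto
  have "\<forall>\<^sub>F t in nhds 0. g v w \<bullet> ((\<alpha> v t - p v) - (\<alpha> w t - p w)) = 0"
    if e: "{v, w} \<in> E" for v w
  proof -
    have "v \<in> V" "w \<in> V"
      using graph e by (auto simp: bar_joint_framework_def simple_graph_def nsets_def)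
    then have "((\<lambda>t. \<alpha> v t - \<alpha> w t) \<longlongrightarrow> p v - p w) (nhds 0)"
      by (intro tendsto_intros lim)
    from linearizes_edges_tendsto[OF lin e this] small show ?thesis
    proof eventually_elim
      case (elim t)
      then have "polyhedral_norm P (\<alpha> v t - \<alpha> w t) = polyhedral_norm P (p v - p w)"
        using \<alpha> e by (simp add: continuous_flex_def)
      with elim(1) show ?case by (simp add: algebra_simps)
    qed
  qed
  then have "\<forall>\<^sub>F t in nhds 0. \<forall>(v, w)\<in>{(v, w). {v, w} \<in> E}.
      g v w \<bullet> ((\<alpha> v t - p v) - (\<alpha> w t - p w)) = 0"
    by (intro eventually_ball_finite fin) auto
  then show ?thesis
    by eventually_elim (auto simp: infinitesimal_flex_iff[OF lin])
qed

section \<open>The two implications\<close>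

lemma continuously_rigid_imp_infinitesimally_rigid:
  assumes "linearizes_edges P E p g" "finite {(v, w). {v, w} \<in> E}"
    and rigid: "continuously_rigid P V E p"
  shows "infinitesimally_rigid P V E p"
  unfolding infinitesimally_rigid_def
proof (intro allI impI)
  fix u assume "infinitesimal_flex P E p u"
  then obtain \<delta> where "continuous_flex P V E p \<delta> (\<lambda>v t. p v + t *\<^sub>R u v)"
    using continuous_flex_of_infinitesimal_flex assms(1,2) by blast
  then have "trivial_continuous_flex V p \<delta> (\<lambda>v t. p v + t *\<^sub>R u v)"
    using rigid by (simp add: continuously_rigid_def)
  then obtain \<epsilon> c where "0 < \<epsilon>" and
      c: "\<And>v t. v \<in> V \<Longrightarrow> t \<in> {-\<epsilon><..<\<epsilon>} \<Longrightarrow> p v + t *\<^sub>R u v = p v + c t"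
    unfolding trivial_continuous_flex_def by blast
  \<comment> \<open>A single nonzero time in the interval recovers \<open>u v\<close> from a
    translation that is the same for all vertices.\<close>
  have "u v = c (\<epsilon>/2) /\<^sub>R (\<epsilon>/2)" if "v \<in> V" for v
  proof -
    have "(\<epsilon>/2) *\<^sub>R u v = c (\<epsilon>/2)" using c[OF that, of "\<epsilon>/2"] \<open>0 < \<epsilon>\<close> by simp
    then show ?thesis using \<open>0 < \<epsilon>\<close> by (metis divideR_right half_gt_zero less_numeral_extra(3))
  qed
  then show "trivial_infinitesimal_flex V u" by (auto simp: trivial_infinitesimal_flex_def)
qed

text \<open>At each small time rigidity makes the displacement the same at all vertices. Reading
  this common value off at one fixed vertex \<open>z\<close> makes it continuous in
  \<open>t\<close>.\<close>

lemma infinitesimally_rigid_imp_continuously_rigid: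
  assumes "linearizes_edges P E p g" "finite {(v, w). {v, w} \<in> E}" "bar_joint_framework V E p"
    and rigid: "infinitesimally_rigid P V E p"
  shows "continuously_rigid P V E p"
  unfolding continuously_rigid_def
proof (intro allI impI)
  fix \<delta> \<alpha> assume \<alpha>: "continuous_flex P V E p \<delta> \<alpha>"
  then have "0 < \<delta>" by (simp add: continuous_flex_def)
  show "trivial_continuous_flex V p \<delta> \<alpha>"
  \<comment> \<open>Without vertices there is no path to read the translation from, so the zero
    translation is taken.\<close>
  proof (cases "V = {}")
    case True
    then show ?thesis
      unfolding trivial_continuous_flex_def using \<open>0 < \<delta>\<close>
      by (intro exI[of _ \<delta>] exI[of _ "\<lambda>_. 0"]) auto
  next
    case False
    then obtain z where "z \<in> V" by blast
    have "\<forall>\<^sub>F t in nhds 0. infinitesimal_flex P E p (\<lambda>v. \<alpha> v t - p v)"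
      using infinitesimal_flex_of_continuous_flex[OF assms(1-3) \<alpha>] .
    then obtain \<eta> where "0 < \<eta>" and
        \<eta>: "\<And>t. \<bar>t\<bar> < \<eta> \<Longrightarrow> infinitesimal_flex P E p (\<lambda>v. \<alpha> v t - p v)"
      unfolding eventually_nhds_metric by (auto simp: dist_real_def)
    \<comment> \<open>Below \<open>\<delta>\<close> the path of \<open>z\<close> is continuous;
      below \<open>\<eta>\<close> displacements are infinitesimal flexes.\<close>
    define \<epsilon> where "\<epsilon> = min \<delta> \<eta>"
    have "\<alpha> v t = p v + (\<alpha> z t - p z)" if "v \<in> V" "t \<in> {-\<epsilon><..<\<epsilon>}" for v t
    proof -
      have "\<bar>t\<bar> < \<eta>" using that(2) by (auto simp: \<epsilon>_def)
      then obtain c where "\<And>v. v \<in> V \<Longrightarrow> \<alpha> v t - p v = c"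
        using rigid \<eta> unfolding infinitesimally_rigid_def trivial_infinitesimal_flex_def by blast
      from this[OF that(1)] this[OF \<open>z \<in> V\<close>] show ?thesis by (simp add: algebra_simps)
    qed
    moreover have "continuous_on {-\<epsilon><..<\<epsilon>} (\<alpha> z)"
    proof (rule continuous_on_subset)
      show "continuous_on {-\<delta><..<\<delta>} (\<alpha> z)"
        using \<alpha> \<open>z \<in> V\<close> by (simp add: continuous_flex_def)
    qed (auto simp: \<epsilon>_def)
    then have "continuous_on {-\<epsilon><..<\<epsilon>} (\<lambda>t. \<alpha> z t - p z)"
      by (intro continuous_intros)
    moreover have "0 < \<epsilon>" "\<epsilon> \<le> \<delta>" using \<open>0 < \<delta>\<close> \<open>0 < \<eta>\<close> by (auto simp: \<epsilon>_def)
    ultimately show ?thesis unfolding trivial_continuous_flex_def by blast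
  qed
qed

theorem theorem2p7:
  fixes P :: "(real ^ 'd) set"
    and V :: "'v set"
    and E :: "'v set set"
    and p :: "'v \<Rightarrow> real ^ 'd"
  assumes "CARD('d) \<ge> 2"
    and "symmetric_polytope P"
    and "finite V"
    and "bar_joint_framework V E p"
    and "well_positioned P E p"
  shows "continuously_rigid P V E p \<longleftrightarrow> infinitesimally_rigid P V E p"
proof -
  obtain g where "linearizes_edges P E p g"
    using well_positioned_linearizes_edges assms(2,4,5) by blast
  then show ?thesis
    using continuously_rigid_imp_infinitesimally_rigid infinitesimally_rigid_imp_continuously_rigid
      finite_edge_pairs[OF assms(4,3)] assms(4) by metis
qed

end
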